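(* Suppose $d\in\mathbb N$ and $\vartheta'\in\mathbb R$. If $1\le\vartheta'<\vartheta(d)$, then there is $g\in\mathbb N$ and $A\in\mathbb S_d^g$ such that $[-1,1]^g\subseteq\mathscr S_{L_A}$, but $\mathfrak C^{(g)}(d)\not\subseteq\vartheta'\,\mathcal D_{L_A}(d)$.
   Context: $\mathbb S_n$ is the set of real symmetric $n\times n$ matrices. For $A=(A_1,\dots,A_g)\in\mathbb S_\nu^g$: $L_A(x)=I_\nu-\sum_jA_jx_j$, $\mathscr S_{L_A}=\{x\in\mathbb R^g:L_A(x)\succeq0\}$, and $\mathcal D_{L_A}(n)=\{X\in\mathbb S_n^g:I_{\nu n}-\sum_jA_j\otimes X_j\succeq0\}$. The free cube $\mathfrak C^{(g)}$ has levels $\mathfrak C^{(g)}(n)=\{X\in\mathbb S_n^g:\|X_j\|\le1\text{ for all }j\}$ (operator norm). The constant $\vartheta(d)$ is defined by $\frac1{\vartheta(d)}=\min\big\{\int_{S^{d-1}}|\xi^*B\xi|\,d\xi:\ B\in\mathbb S_d,\ \operatorname{tr}|B|=d\big\}$, where the unit sphere $S^{d-1}\subseteq\mathbb R^d$ carries the rotation invariant probability measure. *)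

theory Defs
  imports "HOL-Probability.Probability"
begin

text \<open>
  Dimensions of matrices are index types. A \<open>g\<close>-tuple is a list of length \<open>g\<close>, so that \<open>g\<close> can
  be quantified inside a formula.
\<close>

definition sym_mats :: "(real ^ 'n ^ 'n) set" where
  "sym_mats = {M. transpose M = M}"

definition sym_tuples :: "nat \<Rightarrow> (real ^ 'n ^ 'n) list set" where
  "sym_tuples g = {X. length X = g \<and> set X \<subseteq> sym_mats}"

definition psd :: "real ^ 'n ^ 'n \<Rightarrow> bool" where
  "psd M \<longleftrightarrow> M \<in> sym_mats \<and> (\<forall>v. 0 \<le> v \<bullet> (M *v v))"

definition kron :: "real ^ 'm ^ 'm \<Rightarrow> real ^ 'n ^ 'n \<Rightarrow> real ^ ('m \<times> 'n) ^ ('m \<times> 'n)"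
    (infixl "\<otimes>\<^sub>K" 70) where
  "A \<otimes>\<^sub>K B = (\<chi> i j. A $ fst i $ fst j * B $ snd i $ snd j)"

definition spectrahedron :: "(real ^ 'm ^ 'm) list \<Rightarrow> real list set" where
  "spectrahedron A =
     {x. length x = length A \<and> psd (mat 1 - (\<Sum>j<length A. (x ! j) *\<^sub>R (A ! j)))}"

text \<open>The level of the free spectrahedron consisting of tuples of \<open>'n\<close>-by-\<open>'n\<close> matrices.\<close>

definition free_spectrahedron :: "(real ^ 'm ^ 'm) list \<Rightarrow> (real ^ 'n ^ 'n) list set" where
  "free_spectrahedron A =
     {X \<in> sym_tuples (length A). psd (mat 1 - (\<Sum>j<length A. (A ! j) \<otimes>\<^sub>K (X ! j)))}"

definition cube :: "nat \<Rightarrow> real list set" where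
  "cube g = {x. length x = g \<and> set x \<subseteq> {-1..1}}"

text \<open>The norm on the type of matrices is the Frobenius norm; the operator norm is \<^const>\<open>onorm\<close>.\<close>

definition free_cube :: "nat \<Rightarrow> (real ^ 'n ^ 'n) list set" where
  "free_cube g = {X \<in> sym_tuples g. \<forall>M \<in> set X. onorm ((*v) M) \<le> 1}"

definition scale_tuples :: "real \<Rightarrow> 'a::real_vector list set \<Rightarrow> 'a list set" where
  "scale_tuples c S = (\<lambda>X. map ((*\<^sub>R) c) X) ` S"

text \<open>\<open>|B|\<close> is the unique positive semidefinite square root of the Gram matrix of \<open>B\<close>.\<close>

definition mat_abs :: "real ^ 'n ^ 'n \<Rightarrow> real ^ 'n ^ 'n" where
  "mat_abs B = (THE P. psd P \<and> P ** P = transpose B ** B)"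

text \<open>
  The rotation invariant probability measure on the unit sphere, as a Borel measure on the
  ambient space: the image of the uniform distribution on the unit ball under the radial
  projection \<^term>\<open>sgn x = x /\<^sub>R norm x\<close>. That it is a probability measure, carried by
  the sphere and invariant under orthogonal transformations (which determines it) is proved below.
\<close>

definition sphere_measure :: "(real ^ 'd) measure" where
  "sphere_measure = distr (uniform_measure lborel (ball 0 1)) borel sgn"

text \<open>
  The minimum in the definition of \<open>\<vartheta>(d)\<close> is attained, by compactness, so it is the infimum.
\<close>

definition theta :: "'d::finite itself \<Rightarrow> real" where
  "theta _ = 1 / Inf {\<integral>\<xi>. \<bar>\<xi> \<bullet> (B *v \<xi>)\<bar> \<partial>sphere_measure | B :: real ^ 'd ^ 'd.
     B \<in> sym_mats \<and> trace (mat_abs B) = real CARD('d)}"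

lemma sgn_borel [measurable]: "(sgn :: real ^ 'd \<Rightarrow> _) \<in> borel_measurable borel"
  unfolding sgn_div_norm by measurable

lemma sets_sphere_measure [simp, measurable_cong]: "sets sphere_measure = sets borel"
  by (simp add: sphere_measure_def)

lemma emeasure_unit_ball:
  "emeasure lborel (ball (0 :: real ^ 'd) 1) \<noteq> 0" "emeasure lborel (ball (0 :: real ^ 'd) 1) \<noteq> \<infinity>"
proof -
  show "emeasure lborel (ball (0 :: real ^ 'd) 1) \<noteq> 0"
    using open_not_negligible[of "ball (0 :: real ^ 'd) 1"]
    by (auto simp: negligible_iff_null_sets null_sets_def emeasure_completion)
  show "emeasure lborel (ball (0 :: real ^ 'd) 1) \<noteq> \<infinity>"
    using emeasure_bounded_finite[OF bounded_ball, of "0 :: real ^ 'd" 1] by simp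
qed

lemma prob_space_sphere_measure: "prob_space (sphere_measure :: (real ^ 'd) measure)"
  unfolding sphere_measure_def
  by (intro prob_space.prob_space_distr prob_space_uniform_measure emeasure_unit_ball) simp_all

lemma emeasure_sphere_measure:
  fixes A :: "(real ^ 'd) set"
  assumes "A \<in> sets borel"
  shows "emeasure sphere_measure A =
    emeasure lborel (ball 0 1 \<inter> sgn -` A) / emeasure lborel (ball (0 :: real ^ 'd) 1)"
proof -
  have "sgn -` A \<in> sets borel"
    using measurable_sets[OF sgn_borel assms] by simp
  then show ?thesis
    using assms by (simp add: sphere_measure_def emeasure_distr)
qed

lemma AE_sphere_measure: "AE \<xi> in (sphere_measure :: (real ^ 'd) measure). \<xi> \<in> sphere 0 1"
proof -
  have "AE x :: real ^ 'd in lborel. x \<noteq> 0"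
    by (rule AE_lborel_singleton)
  then have "AE x :: real ^ 'd in uniform_measure lborel (ball 0 1). norm (sgn x) = 1"
    by (intro AE_uniform_measureI) (auto simp: norm_sgn)
  then show ?thesis
    unfolding sphere_measure_def by (subst AE_distr_iff) auto
qed

lemma distr_orthogonal_lborel:
  fixes f :: "'a::euclidean_space \<Rightarrow> 'a"
  assumes f: "orthogonal_transformation f"
  shows "distr lborel borel f = lborel"
proof -
  have [measurable]: "f \<in> borel_measurable borel"
    using f orthogonal_transformation_linear linear_continuous_on linear_conv_bounded_linear
    by (intro borel_measurable_continuous_onI) blast
  define M where "M = distr lborel borel f"
  have sM: "sets M = sets borel" by (simp add: M_def)
  define g where "g = inv f"
  have g: "orthogonal_transformation g"
    unfolding g_def using f by (rule orthogonal_transformation_inv)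
  have vim: "f -` S = g ` S" for S
    unfolding g_def using f by (intro bij_vimage_eq_inv_image orthogonal_transformation_bij)
  have M: "emeasure M S = emeasure lborel (g ` S)" if "S \<in> sets borel" for S
    using that by (simp add: M_def emeasure_distr vim)
  have gS: "g ` S \<in> sets borel" if "S \<in> sets borel" for S
    using measurable_sets[of f borel borel S] that by (simp add: vim)
  have null: "emeasure lborel S = 0 \<and> emeasure M S = 0" if "S \<in> sets borel" "negligible S" for S
  proof -
    have "negligible (g ` S)"
      using that g by (intro negligible_differentiable_image_negligible)
        (auto intro: linear_imp_differentiable_on orthogonal_transformation_linear)
    then show ?thesis
      using that gS[OF that(1)]
      by (auto simp: M negligible_iff_null_sets null_sets_def)
  qed
  have U: "emeasure M U = emeasure lborel U" if "open U" for U
  proof -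
    define K where "K = {p :: 'a \<times> real. ball (fst p) (snd p) \<subseteq> U}"
    have "\<exists>i. i \<in> K \<and> x \<in> ball (fst i) (snd i) \<and> snd i < d" if "x \<in> U" "0 < d" for x d
    proof -
      obtain e where e: "e > 0" "ball x e \<subseteq> U"
        using \<open>open U\<close> \<open>x \<in> U\<close> openE by blast
      have "ball x (min e (d/2)) \<subseteq> U"
        using e by auto
      then show ?thesis
        using e \<open>0 < d\<close> by (intro exI[of _ "(x, min e (d/2))"]) (auto simp: K_def)
    qed
    then obtain C where C: "countable C" "C \<subseteq> K"
        "pairwise (\<lambda>i j. disjnt (ball (fst i) (snd i)) (ball (fst j) (snd j))) C"
        "negligible (U - (\<Union>i\<in>C. ball (fst i) (snd i)))"
      by (rule Vitali_covering_theorem_balls)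
    let ?B = "\<lambda>i :: 'a \<times> real. ball (fst i) (snd i)"
    have disj: "disjoint_family_on ?B C"
      using C(3) by (auto simp: disjoint_family_on_def pairwise_def disjnt_def)
    have UB: "(\<Union>i\<in>C. ?B i) \<union> (U - (\<Union>i\<in>C. ?B i)) = U"
      using C(2) by (auto simp: K_def)
    have Bb: "(\<Union>i\<in>C. ?B i) \<in> sets borel"
      by (intro borel_open open_UN) auto
    have Nb: "U - (\<Union>i\<in>C. ?B i) \<in> sets borel"
      using \<open>open U\<close> Bb by auto
    have split: "emeasure N U = (\<integral>\<^sup>+i. emeasure N (?B i) \<partial>count_space C)"
      if N: "sets N = sets borel" "emeasure N (U - (\<Union>i\<in>C. ?B i)) = 0" for N :: "'a measure"
    proof -
      have "emeasure N U = emeasure N ((\<Union>i\<in>C. ?B i) \<union> (U - (\<Union>i\<in>C. ?B i)))"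
        by (simp only: UB)
      also have "\<dots> = emeasure N (\<Union>i\<in>C. ?B i)"
        using N Bb Nb by (intro emeasure_Un_null_set) (auto simp: null_sets_def)
      also have "\<dots> = (\<integral>\<^sup>+i. emeasure N (?B i) \<partial>count_space C)"
        using N C(1) disj by (intro emeasure_UN_countable) auto
      finally show ?thesis .
    qed
    have "emeasure M (?B i) = emeasure lborel (?B i)" for i
    proof (cases "snd i \<ge> 0")
      case True
      then show ?thesis
        using g by (simp add: M image_orthogonal_transformation_ball emeasure_ball)
    qed (simp add: ball_empty)
    then show ?thesis
      using split[of M] split[of lborel] null[OF Nb C(4)] sM by simp
  qed
  have "lborel = M"
    by (rule lborel_eqI) (simp_all add: U[OF open_box] emeasure_lborel_box sM)
  then show ?thesis by (simp add: M_def)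
qed

lemma distr_orthogonal_sphere_measure:
  fixes f :: "real ^ 'd \<Rightarrow> real ^ 'd"
  assumes f: "orthogonal_transformation f"
  shows "distr sphere_measure borel f = sphere_measure"
proof (rule measure_eqI)
  have fm [measurable]: "f \<in> borel_measurable borel"
    using f orthogonal_transformation_linear linear_continuous_on linear_conv_bounded_linear
    by (intro borel_measurable_continuous_onI) blast
  fix A assume "A \<in> sets (distr sphere_measure borel f)"
  then have A: "A \<in> sets borel" by simp
  define S where "S = ball 0 1 \<inter> sgn -` A"
  have S: "S \<in> sets borel"
    using measurable_sets[OF sgn_borel A] by (simp add: S_def)
  have fA: "f -` A \<in> sets borel"
    using measurable_sets[OF fm A] by simp
  have "sgn (f x) = f (sgn x)" for x
    using f by (simp add: sgn_div_norm orthogonal_transformation_norm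
        orthogonal_transformation_scaleR)
  then have "ball 0 1 \<inter> sgn -` (f -` A) = f -` S"
    using f by (auto simp: S_def orthogonal_transformation_norm)
  moreover have "emeasure lborel (f -` S) = emeasure (distr lborel borel f) S"
    using S by (simp add: emeasure_distr)
  ultimately show "emeasure (distr sphere_measure borel f) A = emeasure sphere_measure A"
    using A fA f
    by (simp add: emeasure_distr emeasure_sphere_measure distr_orthogonal_lborel S_def
        sphere_measure_def[THEN arg_cong, of space])
qed simp

end

theory Submission
  imports Defs
begin

text \<open>
  Choose a symmetric \<open>B\<close> with \<open>tr \<bar>B\<bar> = d\<close> for which the integral of \<open>\<bar>\<xi> \<bullet> B \<xi>\<bar>\<close> over the unit sphere is less than
  \<open>1 / \<theta>'\<close>, and a number \<open>r\<close> strictly between the two. Let \<open>J\<close> be the sign of \<open>B\<close>, a symmetric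
  contraction with \<open>B J = \<bar>B\<bar>\<close>.

  Averaging \<open>\<bar>(U v) \<bullet> B (U v)\<bar>\<close> over all rotations \<open>U\<close> gives \<open>\<bar>v\<bar>\<^sup>2\<close> times the integral. Finitely many
  orthogonal matrices \<open>Q\<^sub>1, \<dots>, Q\<^sub>g\<close> already make the average at most \<open>r \<bar>v\<bar>\<^sup>2\<close>, uniformly in \<open>v\<close>; this is
  \<open>rotation_average_quadratic_form\<close>, which rests on \<open>rotation_mean_le_spherical_mean\<close>. Put

    \<open>A\<^sub>j = Q\<^sub>j\<^sup>T B Q\<^sub>j / (g r)\<close>  and  \<open>X\<^sub>j = Q\<^sub>j\<^sup>T J Q\<^sub>j\<close>.

  The bound on the average says that \<open>\<Sum>j. x\<^sub>j (v \<bullet> A\<^sub>j v) \<le> \<bar>v\<bar>\<^sup>2\<close> for all \<open>x\<close> in the cube, so the cube lies in the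
  spectrahedron of \<open>A\<close>. The tuple \<open>X\<close> lies in the free cube since \<open>J\<close> is a contraction. Finally test
  the linear pencil of \<open>A\<close> at \<open>X / \<theta>'\<close> on the vector \<open>\<Sum>i. e\<^sub>i \<otimes> e\<^sub>i\<close>, whose squared norm is \<open>d\<close>: every
  index \<open>j\<close> contributes \<open>tr (B J) / (g r \<theta>') = d / (g r \<theta>')\<close>, and the total \<open>d / (r \<theta>')\<close> exceeds \<open>d\<close>
  because \<open>r < 1 / \<theta>'\<close>. Hence \<open>X\<close> is not in \<open>\<theta>'\<close> times the free spectrahedron.

  The matrix \<open>\<bar>B\<bar>\<close> is given by a definite description, so the existence and uniqueness of positive
  semidefinite square roots are needed; they and \<open>J\<close> come from the spectral theorem for symmetric
  matrices (\<open>sym_mat_spectral\<close>).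
\<close>

section \<open>Symmetric matrices: spectral theorem, absolute value and sign\<close>

text \<open>
  A maximiser \<open>v\<close> of the quadratic form \<open>x \<bullet> f x\<close> on the unit sphere of \<open>S\<close> is an eigenvector:
  with \<open>c\<close> the maximum, \<open>q x = c (x \<bullet> x) - x \<bullet> f x\<close> is nonnegative on \<open>S\<close> and vanishes at \<open>v\<close>,
  so its derivative at \<open>v\<close> in the direction \<open>w = c v - f v\<close>, which is \<open>2 (w \<bullet> w)\<close>, must vanish.
\<close>

lemma self_adjoint_eigenvector:
  fixes f :: "'a::euclidean_space \<Rightarrow> 'a"
  assumes f: "linear f" and adj: "\<And>x y. f x \<bullet> y = x \<bullet> f y"
    and S: "subspace S" "f ` S \<subseteq> S" "S \<noteq> {0}"
  obtains v c where "v \<in> S" "norm v = 1" "f v = c *\<^sub>R v"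
proof -
  have "compact (sphere 0 1 \<inter> S)"
    using S(1) by (intro compact_Int_closed closed_subspace) auto
  moreover have "sphere 0 1 \<inter> S \<noteq> {}"
  proof -
    obtain x where "x \<in> S" "x \<noteq> 0"
      using S(1,3) subspace_0 by blast
    then have "sgn x \<in> sphere 0 1 \<inter> S"
      using S(1) by (simp add: norm_sgn) (simp add: sgn_div_norm subspace_scale)
    then show ?thesis by blast
  qed
  moreover have "continuous_on (sphere 0 1 \<inter> S) (\<lambda>x. x \<bullet> f x)"
    using linear_continuous_on[of f] f linear_conv_bounded_linear
    by (intro continuous_intros) auto
  ultimately obtain v where v: "v \<in> S" "norm v = 1"
    and max: "\<And>y. y \<in> S \<Longrightarrow> norm y = 1 \<Longrightarrow> y \<bullet> f y \<le> v \<bullet> f v"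
    using continuous_attains_sup[of "sphere 0 1 \<inter> S" "\<lambda>x. x \<bullet> f x"]
    by (metis IntE IntI mem_sphere_0)
  define c where "c = v \<bullet> f v"
  define q where "q x = c * (x \<bullet> x) - x \<bullet> f x" for x
  have q_nonneg: "q x \<ge> 0" if "x \<in> S" for x
  proof (cases "x = 0")
    case False
    have "sgn x \<bullet> f (sgn x) \<le> c"
      using that False S(1) unfolding c_def
      by (intro max) (auto simp: norm_sgn, simp add: sgn_div_norm subspace_scale)
    moreover have "x = norm x *\<^sub>R sgn x"
      using False by (simp add: sgn_div_norm)
    then have "x \<bullet> f x = (norm x)\<^sup>2 * (sgn x \<bullet> f (sgn x))"
      using linear_scale[OF f, of "norm x" "sgn x"]
      by (smt (verit) inner_scaleR_left inner_scaleR_right mult.assoc power2_eq_square)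
    ultimately show ?thesis
      by (simp add: q_def dot_square_norm mult.commute mult_left_mono mult_right_mono)
  qed (simp add: q_def)
  define w where "w = c *\<^sub>R v - f v"
  have w: "w \<in> S"
    using S v by (auto simp: w_def intro!: subspace_diff subspace_scale)
  have q_line: "q (v + t *\<^sub>R w) = 2 * t * (w \<bullet> w) + t\<^sup>2 * q w" for t
  proof -
    have "q (v + t *\<^sub>R w) = q v + 2 * t * (w \<bullet> (c *\<^sub>R v - f v)) + t\<^sup>2 * q w"
      using adj[of v w] by (simp add: q_def linear_add[OF f] linear_scale[OF f] inner_add_left
          inner_add_right inner_diff_right power2_eq_square inner_commute algebra_simps)
    moreover have "q v = 0"
      using v(2) by (simp add: q_def c_def dot_square_norm)
    ultimately show ?thesis by (simp add: w_def)
  qed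
  have "w \<bullet> w = 0"
  proof (rule ccontr)
    assume *: "w \<bullet> w \<noteq> 0"
    then have pos: "w \<bullet> w > 0" using inner_ge_zero[of w] by linarith
    \<comment> \<open>A small negative step along \<open>w\<close> makes \<open>q\<close> negative; the summand 1 keeps the
      denominator nonzero if \<open>q w = 0\<close>.\<close>
    define t where "t = - (w \<bullet> w) / (q w + 1)"
    have "q w \<ge> 0" using q_nonneg w .
    then have "t < 0" "t * q w > - (w \<bullet> w) * 1"
      using pos by (auto simp: t_def field_simps)
    then have "2 * (w \<bullet> w) + t * q w > 0" using pos by linarith
    then have "t * (2 * (w \<bullet> w) + t * q w) < 0"
      using \<open>t < 0\<close> by (rule mult_neg_pos[rotated])
    moreover have "q (v + t *\<^sub>R w) \<ge> 0"
      using S v w by (intro q_nonneg subspace_add subspace_scale) auto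
    ultimately show False
      unfolding q_line by (simp add: power2_eq_square algebra_simps)
  qed
  then have "f v = c *\<^sub>R v" by (simp add: w_def)
  then show ?thesis using that v by blast
qed

definition orthonormal :: "'a::real_inner set \<Rightarrow> bool" where
  "orthonormal E \<longleftrightarrow> pairwise orthogonal E \<and> (\<forall>e\<in>E. norm e = 1)"

text \<open>
  The spectral theorem, by induction on the dimension: the orthogonal complement in \<open>S\<close> of an
  eigenvector is again invariant, because \<open>f\<close> is self-adjoint. Invariant subspaces, and not only
  the whole space, are needed to make this induction possible.
\<close>

lemma self_adjoint_orthonormal_eigenvectors:
  fixes f :: "'a::euclidean_space \<Rightarrow> 'a"
  assumes f: "linear f" and adj: "\<And>x y. f x \<bullet> y = x \<bullet> f y"
    and "subspace S" "f ` S \<subseteq> S"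
  shows "\<exists>E ev. orthonormal E \<and> (\<forall>e\<in>E. f e = ev e *\<^sub>R e) \<and> span E = S"
  using assms(3,4)
proof (induction "dim S" arbitrary: S rule: less_induct)
  case less
  show ?case
  proof (cases "S = {0}")
    case True
    then show ?thesis by (intro exI[of _ "{}"]) (auto simp: orthonormal_def)
  next
    case False
    then obtain v c where v: "v \<in> S" "norm v = 1" "f v = c *\<^sub>R v"
      using self_adjoint_eigenvector[OF f adj less.prems] by blast
    define T where "T = {y \<in> S. v \<bullet> y = 0}"
    have T: "subspace T"
      using less.prems(1) by (auto simp: T_def subspace_def inner_add_right)
    have fT: "f ` T \<subseteq> T"
    proof
      fix z assume "z \<in> f ` T"
      then obtain y where y: "y \<in> S" "v \<bullet> y = 0" "z = f y" by (auto simp: T_def)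
      have "v \<bullet> z = f v \<bullet> y" using adj y(3) by simp
      then show "z \<in> T" using y v(3) less.prems(2) by (auto simp: T_def)
    qed
    have "v \<notin> T" using v(2) by (auto simp: T_def)
    moreover have "T \<subseteq> S" by (auto simp: T_def)
    ultimately have "T \<subset> S" using v(1) by blast
    then have "dim T < dim S"
      using T less.prems(1) by (intro dim_psubset) (metis span_eq_iff)
    then obtain E ev where E: "orthonormal E" "\<forall>e\<in>E. f e = ev e *\<^sub>R e" "span E = T"
      using less.hyps[of T] T fT by blast
    have vE: "v \<bullet> e = 0" if "e \<in> E" for e
      using that E(3) span_base[of e E] by (auto simp: T_def)
    have "v \<notin> E" using \<open>v \<notin> T\<close> E(3) span_base by blast
    have "orthonormal (insert v E)"
      using E(1) vE v(2) by (auto simp: orthonormal_def pairwise_insert orthogonal_def inner_commute)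
    moreover have "\<forall>e\<in>insert v E. f e = (ev(v := c)) e *\<^sub>R e"
      using E(2) v \<open>v \<notin> E\<close> by auto
    moreover have "span (insert v E) = S"
    proof
      have "insert v E \<subseteq> S"
        using v(1) E(3) span_superset[of E] by (auto simp: T_def)
      then show "span (insert v E) \<subseteq> S"
        using less.prems(1) by (rule span_minimal)
      show "S \<subseteq> span (insert v E)"
      proof
        fix x assume "x \<in> S"
        then have "x - (v \<bullet> x) *\<^sub>R v \<in> span E"
          using v less.prems(1) unfolding E(3)
          by (auto simp: T_def inner_diff_right dot_square_norm intro!: subspace_diff subspace_scale)
        then show "x \<in> span (insert v E)"
          by (auto simp: span_insert)
      qed
    qed
    ultimately show ?thesis by blast
  qed
qed

lemma sym_mats_iff: "M \<in> sym_mats \<longleftrightarrow> (\<forall>x y. (M *v x) \<bullet> y = x \<bullet> (M *v y))"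
proof -
  have key: "(transpose M *v x) \<bullet> y = x \<bullet> (M *v y)" for x y
    using dot_lmul_matrix[of x M y] by simp
  show ?thesis
  proof
    assume "M \<in> sym_mats"
    then show "\<forall>x y. (M *v x) \<bullet> y = x \<bullet> (M *v y)"
      using key by (simp add: sym_mats_def)
  next
    assume *: "\<forall>x y. (M *v x) \<bullet> y = x \<bullet> (M *v y)"
    have "transpose M *v x = M *v x" for x
    proof -
      have "\<forall>y. (transpose M *v x) \<bullet> y = (M *v x) \<bullet> y" using key * by simp
      then show ?thesis by (simp only: vector_eq_rdot)
    qed
    then show "M \<in> sym_mats"
      by (simp only: sym_mats_def mem_Collect_eq matrix_eq simp_thms)
  qed
qed

text \<open>
  The matrix \<open>\<Sum>e\<in>E. \<phi> e e e\<^sup>T\<close>. With the orthonormal set \<open>E\<close> fixed, this is the functional calculus: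
  a matrix with eigenvalues \<open>\<phi>\<close> is transformed by transforming \<open>\<phi>\<close>.
\<close>

definition rank_one_sum :: "(real ^ 'n) set \<Rightarrow> (real ^ 'n \<Rightarrow> real) \<Rightarrow> real ^ 'n ^ 'n" where
  "rank_one_sum E \<phi> = matrix (\<lambda>w. \<Sum>e\<in>E. (\<phi> e * (e \<bullet> w)) *\<^sub>R e)"

lemma rank_one_sum_apply: "rank_one_sum E \<phi> *v w = (\<Sum>e\<in>E. (\<phi> e * (e \<bullet> w)) *\<^sub>R e)"
proof -
  have "linear (\<lambda>w. \<Sum>e\<in>E. (\<phi> e * (e \<bullet> w)) *\<^sub>R e)"
    by (intro linear_compose_sum ballI linearI) (auto simp: inner_add_right algebra_simps)
  then show ?thesis
    unfolding rank_one_sum_def by (simp add: matrix_works)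
qed

lemma inner_rank_one_sum:
  "v \<bullet> (rank_one_sum E \<phi> *v w) = (\<Sum>e\<in>E. \<phi> e * (e \<bullet> v) * (e \<bullet> w))"
  by (simp add: rank_one_sum_apply inner_sum_right inner_commute mult_ac)

lemma rank_one_sum_sym: "rank_one_sum E \<phi> \<in> sym_mats"
  unfolding sym_mats_iff
proof (intro allI)
  fix v w
  have "(rank_one_sum E \<phi> *v v) \<bullet> w = w \<bullet> (rank_one_sum E \<phi> *v v)"
    by (rule inner_commute)
  then show "(rank_one_sum E \<phi> *v v) \<bullet> w = v \<bullet> (rank_one_sum E \<phi> *v w)"
    by (simp add: inner_rank_one_sum mult_ac)
qed

lemma psd_rank_one_sum:
  assumes "\<And>e. e \<in> E \<Longrightarrow> 0 \<le> \<phi> e"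
  shows "psd (rank_one_sum E \<phi>)"
  using assms by (auto simp: psd_def rank_one_sum_sym inner_rank_one_sum mult.assoc intro!: sum_nonneg)

lemma orthonormal_finite:
  fixes E :: "'a::euclidean_space set"
  assumes "orthonormal E"
  shows "finite E"
  using assms by (auto simp: orthonormal_def pairwise_orthogonal_imp_finite)

lemma rank_one_sum_eigenvector:
  assumes E: "orthonormal E" and e: "e \<in> E"
  shows "rank_one_sum E \<phi> *v e = \<phi> e *\<^sub>R e"
proof -
  have "(\<Sum>e'\<in>E. (\<phi> e' * (e' \<bullet> e)) *\<^sub>R e') = (\<Sum>e'\<in>{e}. (\<phi> e' * (e' \<bullet> e)) *\<^sub>R e')"
    using e E orthonormal_finite[OF E]
    by (intro sum.mono_neutral_right) (auto simp: orthonormal_def pairwise_def orthogonal_def)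
  then show ?thesis
    using E e by (simp add: orthonormal_def rank_one_sum_apply dot_square_norm)
qed

lemma rank_one_sum_mult:
  assumes E: "orthonormal E"
  shows "rank_one_sum E \<phi> ** rank_one_sum E \<psi> = rank_one_sum E (\<lambda>e. \<phi> e * \<psi> e)"
proof -
  have "rank_one_sum E \<phi> *v (rank_one_sum E \<psi> *v w)
      = (\<Sum>e\<in>E. (\<psi> e * (e \<bullet> w)) *\<^sub>R (rank_one_sum E \<phi> *v e))" for w
    unfolding rank_one_sum_apply[of E \<psi>]
    by (simp add: linear_sum[OF matrix_vector_mul_linear] linear_scale[OF matrix_vector_mul_linear])
  also have "\<dots> w = rank_one_sum E (\<lambda>e. \<phi> e * \<psi> e) *v w" for w
    unfolding rank_one_sum_apply[of E "\<lambda>e. \<phi> e * \<psi> e"]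
    by (intro sum.cong) (auto simp: rank_one_sum_eigenvector[OF E] mult_ac)
  finally show ?thesis
    by (simp add: matrix_eq matrix_vector_mul_assoc[symmetric])
qed

lemma sym_mat_spectral:
  fixes M :: "real ^ 'n ^ 'n"
  assumes "M \<in> sym_mats"
  obtains E \<phi> where "orthonormal E" "span E = UNIV"
    "M = rank_one_sum E \<phi>"
proof -
  obtain E ev where E: "orthonormal E" "span E = UNIV"
    and ev: "\<And>e. e \<in> E \<Longrightarrow> M *v e = ev e *\<^sub>R e"
    using self_adjoint_orthonormal_eigenvectors[of "(*v) M" UNIV] assms
    unfolding sym_mats_iff by (metis matrix_vector_mul_linear subspace_UNIV subset_UNIV)
  have "M *v w = rank_one_sum E ev *v w" for w
    using matrix_vector_mul_linear matrix_vector_mul_linear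
    by (rule linear_eq_on_span[of _ _ E])
       (auto simp: ev E(2) rank_one_sum_eigenvector[OF E(1)])
  then have "M = rank_one_sum E ev" by (simp add: matrix_eq)
  then show ?thesis using that E by blast
qed

text \<open>
  Put \<open>D = P - Q\<close>, so that \<open>P D + D Q = P\<^sup>2 - Q\<^sup>2 = 0\<close>. If \<open>e\<close> is an eigenvector of \<open>D\<close> for a nonzero
  eigenvalue, this yields \<open>e \<bullet> P e + e \<bullet> Q e = 0\<close>. Both summands are nonnegative, hence zero, and so
  \<open>e \<bullet> D e = 0\<close>, which contradicts the choice of \<open>e\<close>.
\<close>

lemma psd_square_unique:
  fixes P Q :: "real ^ 'n ^ 'n"
  assumes P: "psd P" and Q: "psd Q" and eq: "P ** P = Q ** Q"
  shows "P = Q"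
proof -
  have Ps: "P \<in> sym_mats" and Qs: "Q \<in> sym_mats"
    using P Q by (auto simp: psd_def)
  then have "P - Q \<in> sym_mats"
    by (simp add: sym_mats_iff matrix_vector_mult_diff_rdistrib inner_diff_left inner_diff_right)
  then obtain E \<phi> where E: "orthonormal E"
    and D: "P - Q = rank_one_sum E \<phi>"
    using sym_mat_spectral by blast
  have "\<phi> e = 0" if e: "e \<in> E" for e
  proof (rule ccontr)
    assume nz: "\<phi> e \<noteq> 0"
    have De: "P *v e - Q *v e = \<phi> e *\<^sub>R e"
      using rank_one_sum_eigenvector[OF E e, of \<phi>] D matrix_vector_mult_diff_rdistrib[of P Q e]
      by simp
    have "P *v (P *v e) = Q *v (Q *v e)"
      using eq by (simp add: matrix_vector_mul_assoc)
    \<comment> \<open>this is \<open>e \<bullet> ((P D + D Q) e)\<close>, with \<open>D\<close> moved to the left argument in the second summand\<close>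
    then have "0 = e \<bullet> (P *v (P *v e - Q *v e)) + (P *v e - Q *v e) \<bullet> (Q *v e)"
      using Ps Qs by (simp add: sym_mats_iff matrix_vector_mult_diff_distrib inner_diff_left inner_diff_right)
    also have "\<dots> = \<phi> e * (e \<bullet> (P *v e) + e \<bullet> (Q *v e))"
      unfolding De by (simp add: linear_scale[OF matrix_vector_mul_linear] algebra_simps)
    finally have "e \<bullet> (P *v e) + e \<bullet> (Q *v e) = 0" using nz by simp
    moreover have "0 \<le> e \<bullet> (P *v e)" "0 \<le> e \<bullet> (Q *v e)"
      using P Q by (auto simp: psd_def)
    ultimately have "e \<bullet> (P *v e - Q *v e) = 0" by (simp add: inner_diff_right)
    then show False
      unfolding De using nz E e by (auto simp: orthonormal_def dot_square_norm)
  qed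
  then have "(P - Q) *v w = 0" for w
    by (simp add: D rank_one_sum_apply)
  then show ?thesis
    by (simp add: matrix_eq matrix_vector_mult_diff_rdistrib)
qed

lemma mat_abs_eqI:
  assumes "psd P" "P ** P = transpose B ** B"
  shows "mat_abs B = P"
  unfolding mat_abs_def
proof (rule the_equality)
  show "psd P \<and> P ** P = transpose B ** B" using assms by blast
next
  fix Q assume "psd Q \<and> Q ** Q = transpose B ** B"
  with assms show "Q = P" by (metis psd_square_unique)
qed

lemma mat_abs_mat_1: "mat_abs (mat 1 :: real ^ 'n ^ 'n) = mat 1"
  by (intro mat_abs_eqI) (auto simp: psd_def sym_mats_def)

text \<open>
  \<open>J\<close> is the sign of \<open>B\<close> in the functional calculus. It shows that the trace norm of \<open>B\<close> is attained
  as the trace pairing of \<open>B\<close> with a symmetric contraction.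
\<close>

lemma sign_matrix:
  fixes B :: "real ^ 'n ^ 'n"
  assumes "B \<in> sym_mats"
  obtains J where "J \<in> sym_mats" "\<And>v. norm (J *v v) \<le> norm v" "B ** J = mat_abs B"
proof -
  obtain E \<phi> where E: "orthonormal E" "span E = UNIV"
    and B: "B = rank_one_sum E \<phi>"
    using assms by (rule sym_mat_spectral)
  define J where "J = rank_one_sum E (\<lambda>e. sgn (\<phi> e))"
  have J: "J \<in> sym_mats" unfolding J_def by (rule rank_one_sum_sym)
  have "mat_abs B = rank_one_sum E (\<lambda>e. \<bar>\<phi> e\<bar>)"
    using assms by (intro mat_abs_eqI psd_rank_one_sum)
      (auto simp: sym_mats_def B rank_one_sum_mult[OF E(1)])
  moreover have "B ** J = rank_one_sum E (\<lambda>e. \<bar>\<phi> e\<bar>)"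
    by (simp add: B J_def rank_one_sum_mult[OF E(1)] abs_sgn)
  moreover have "norm (J *v v) \<le> norm v" for v
  proof -
    have "(J *v v) \<bullet> (J *v v) = v \<bullet> ((J ** J) *v v)"
      using J by (simp add: sym_mats_iff matrix_vector_mul_assoc[symmetric])
    also have "\<dots> = (\<Sum>e\<in>E. (sgn (\<phi> e))\<^sup>2 * (e \<bullet> v)\<^sup>2)"
      by (simp add: J_def rank_one_sum_mult[OF E(1)] inner_rank_one_sum power2_eq_square mult_ac)
    also have "\<dots> \<le> (\<Sum>e\<in>E. 1 * (e \<bullet> v)\<^sup>2)"
      by (intro sum_mono mult_right_mono) (auto simp: sgn_if)
    also have "\<dots> = v \<bullet> (\<Sum>e\<in>E. (v \<bullet> e) *\<^sub>R e)"
      by (simp add: inner_sum_right power2_eq_square inner_commute)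
    also have "\<dots> = v \<bullet> v"
      using E orthonormal_finite[OF E(1)] by (simp add: orthonormal_def orthonormal_basis_expand)
    finally show ?thesis by (simp add: norm_le)
  qed
  ultimately show ?thesis using that J by auto
qed

section \<open>Averaging over rotations\<close>

definition rotation_mean :: "('a \<Rightarrow> real) \<Rightarrow> ('a \<Rightarrow> 'a) list \<Rightarrow> 'a \<Rightarrow> real" where
  "rotation_mean f Us x = (\<Sum>U\<leftarrow>Us. f (U x)) / length Us"

text \<open>
  Averaging twice is averaging once, over the list of all compositions: this is what makes the
  averages closed under further averaging.
\<close>

lemma rotation_mean_compose:
  assumes "Us \<noteq> []"
  shows "rotation_mean f (concat (map (\<lambda>V. map (\<lambda>U. U \<circ> V) Us) Vs)) =
    rotation_mean (rotation_mean f Us) Vs"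
proof
  fix x
  define Ws where "Ws = concat (map (\<lambda>V. map (\<lambda>U. U \<circ> V) Us) Vs)"
  have "length Ws = length Vs * length Us"
    by (simp add: Ws_def length_concat o_def sum_list_triv)
  moreover have "(\<Sum>W\<leftarrow>Ws. f (W x)) = length Us * (\<Sum>V\<leftarrow>Vs. rotation_mean f Us (V x))"
    unfolding Ws_def using assms by (induction Vs) (auto simp: rotation_mean_def o_def distrib_left)
  ultimately show "rotation_mean f Ws x = rotation_mean (rotation_mean f Us) Vs x"
    using assms unfolding rotation_mean_def[of _ Ws] rotation_mean_def[of _ Vs] by simp
qed

lemma integrable_sphere_measure:
  fixes f :: "real ^ 'd \<Rightarrow> real"
  assumes f: "continuous_on UNIV f"
  shows "integrable sphere_measure f"
proof -
  interpret prob_space "sphere_measure :: (real ^ 'd) measure"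
    by (rule prob_space_sphere_measure)
  have "bounded (f ` sphere 0 1)"
    using f by (intro compact_imp_bounded compact_continuous_image) (auto intro: continuous_on_subset)
  then obtain b where "\<forall>x\<in>sphere 0 1. norm (f x) \<le> b"
    by (auto simp: bounded_iff)
  then show ?thesis
    using AE_sphere_measure f
    by (intro integrable_const_bound[of _ b]) (auto simp: measurable_cong_sets[OF sets_sphere_measure refl]
        intro: borel_measurable_continuous_onI elim!: eventually_mono)
qed

lemma continuous_on_orthogonal:
  fixes f :: "'a::euclidean_space \<Rightarrow> real" and U :: "'a \<Rightarrow> 'a"
  assumes "continuous_on UNIV f" "orthogonal_transformation U"
  shows "continuous_on UNIV (\<lambda>x. f (U x))"
proof -
  have "continuous_on UNIV U"
    using assms(2) by (intro linear_continuous_on) (simp add: linear_conv_bounded_linear[symmetric]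
        orthogonal_transformation_linear)
  then show ?thesis using assms(1) continuous_on_compose2 by blast
qed

lemma integral_sphere_measure_orthogonal:
  fixes f :: "real ^ 'd \<Rightarrow> real"
    and U :: "real ^ 'd \<Rightarrow> real ^ 'd"
  assumes f: "continuous_on UNIV f" and U: "orthogonal_transformation U"
  shows "(\<integral>x. f (U x) \<partial>sphere_measure) = (\<integral>x. f x \<partial>sphere_measure)"
proof -
  have "continuous_on UNIV U"
    using U by (intro linear_continuous_on) (simp add: linear_conv_bounded_linear[symmetric]
        orthogonal_transformation_linear)
  then have "(\<integral>x. f x \<partial>distr sphere_measure borel U) = (\<integral>x. f (U x) \<partial>sphere_measure)"
    using f by (intro integral_distr) (auto simp: measurable_cong_sets[OF sets_sphere_measure refl]
        intro: borel_measurable_continuous_onI)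
  then show ?thesis by (simp add: distr_orthogonal_sphere_measure[OF U])
qed

lemma
  fixes f :: "real ^ 'd \<Rightarrow> real" and Us :: "(real ^ 'd \<Rightarrow> real ^ 'd) list"
  assumes f: "continuous_on UNIV f" and U: "\<And>U. U \<in> set Us \<Longrightarrow> orthogonal_transformation U"
  shows continuous_on_rotation_mean: "continuous_on UNIV (rotation_mean f Us)"
    and integral_rotation_mean: "Us \<noteq> [] \<Longrightarrow>
      (\<integral>x. rotation_mean f Us x \<partial>sphere_measure) = (\<integral>x. f x \<partial>sphere_measure)"
proof -
  have eq: "rotation_mean f Us = (\<lambda>x. (\<Sum>i<length Us. f ((Us ! i) x)) / length Us)"
    by (simp add: rotation_mean_def sum_list_sum_nth atLeast0LessThan fun_eq_iff)
  have c: "continuous_on UNIV (\<lambda>x. f ((Us ! i) x))" if "i < length Us" for i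
    using continuous_on_orthogonal[OF f U[of "Us ! i"]] that by simp
  show "continuous_on UNIV (rotation_mean f Us)"
    unfolding eq using c by (cases "Us = []") (auto intro!: continuous_intros)
  show "(\<integral>x. rotation_mean f Us x \<partial>sphere_measure) = (\<integral>x. f x \<partial>sphere_measure)"
    if "Us \<noteq> []"
  proof -
    have "(\<integral>x. rotation_mean f Us x \<partial>sphere_measure) =
        (\<Sum>i<length Us. \<integral>x. f ((Us ! i) x) \<partial>sphere_measure) / length Us"
      unfolding eq using c by (simp add: integrable_sphere_measure)
    then show ?thesis
      using U that f by (simp add: integral_sphere_measure_orthogonal)
  qed
qed

lemma exists_point_le_spherical_mean:
  fixes f :: "real ^ 'd \<Rightarrow> real"
  assumes f: "continuous_on UNIV f"
  obtains p where "norm p = 1" "f p \<le> (\<integral>x. f x \<partial>sphere_measure)"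
proof -
  interpret prob_space "sphere_measure :: (real ^ 'd) measure"
    by (rule prob_space_sphere_measure)
  obtain p where p: "p \<in> sphere 0 1" "\<And>x. x \<in> sphere 0 1 \<Longrightarrow> f p \<le> f x"
    using continuous_attains_inf[of "sphere 0 1" f] continuous_on_subset[OF f] by auto
  have "f p \<le> (\<integral>x. f x \<partial>sphere_measure)"
    using integrable_sphere_measure[OF f] AE_sphere_measure p(2)
    by (intro integral_ge_const) (auto elim!: eventually_mono)
  then show ?thesis using that p(1) by auto
qed

text \<open>
  A substitute for averaging over the Haar measure of the orthogonal group that needs only finitely
  many rotations. Let \<open>m\<close> be the spherical mean of \<open>f\<close>. Every rotation average \<open>h\<close> of \<open>f\<close> has the mean \<open>m\<close>
  too, so \<open>h q \<le> m\<close> for some point \<open>q\<close> of the sphere. All averages have the modulus of continuity of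
  \<open>f\<close>, hence \<open>h\<close> is at most \<open>m + \<epsilon> / 2\<close> on the \<open>\<delta>\<close>-ball around \<open>q\<close>, where \<open>\<delta>\<close> does not depend on \<open>h\<close>. Take a
  finite \<open>\<delta>\<close>-net of the sphere with \<open>N\<close> points, and average \<open>h\<close> over rotations that carry the points of
  the net to \<open>q\<close>. At each point of the sphere, one of the \<open>N\<close> summands is then evaluated near \<open>q\<close>, so
  an upper bound \<open>b\<close> of \<open>h\<close> can be lowered by \<open>(b - (m + \<epsilon> / 2)) / N\<close>. As \<open>N\<close> is the same in every round,
  the infimum of all such upper bounds cannot exceed \<open>m + \<epsilon> / 2\<close>.
\<close>

lemma rotation_mean_le_spherical_mean:
  fixes f :: "real ^ 'd \<Rightarrow> real"
  assumes f: "continuous_on UNIV f" and "0 < \<epsilon>"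
  obtains Us :: "(real ^ 'd \<Rightarrow> real ^ 'd) list" where "Us \<noteq> []" "\<And>U. U \<in> set Us \<Longrightarrow> orthogonal_transformation U"
    "\<And>x. norm x = 1 \<Longrightarrow> rotation_mean f Us x \<le> (\<integral>x. f x \<partial>sphere_measure) + \<epsilon>"
proof -
  define m where "m = (\<integral>x. f x \<partial>sphere_measure)"
  define rots where "rots = {Us :: (real ^ 'd \<Rightarrow> real ^ 'd) list.
    Us \<noteq> [] \<and> (\<forall>U\<in>set Us. orthogonal_transformation U)}"
  define bounds where "bounds = {b. \<exists>Us\<in>rots. \<forall>x. norm x = 1 \<longrightarrow> rotation_mean f Us x \<le> b}"
  obtain \<delta> where \<delta>: "\<delta> > 0" and
    unif: "\<And>x y. norm x = 1 \<Longrightarrow> norm y = 1 \<Longrightarrow> dist x y < \<delta> \<Longrightarrow> f x < f y + \<epsilon> / 2"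
  proof -
    have "uniformly_continuous_on (sphere 0 1) f"
      using f by (intro compact_uniformly_continuous) (auto intro: continuous_on_subset)
    then obtain \<delta> where "\<delta> > 0"
      "\<forall>x\<in>sphere 0 1. \<forall>x'\<in>sphere 0 1. dist x' x < \<delta> \<longrightarrow> dist (f x') (f x) < \<epsilon> / 2"
      unfolding uniformly_continuous_on_def using \<open>0 < \<epsilon>\<close> half_gt_zero by blast
    then show ?thesis
      by (intro that[of \<delta>]) (smt (verit) dist_real_def mem_sphere_0)+
  qed
  have equi: "rotation_mean f Us x \<le> rotation_mean f Us y + \<epsilon> / 2"
    if Us: "Us \<in> rots" and xy: "norm x = 1" "norm y = 1" "dist x y < \<delta>" for Us x y
  proof -
    have "f (U x) \<le> f (U y) + \<epsilon> / 2" if "U \<in> set Us" for U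
    proof -
      have U: "orthogonal_transformation U" using Us that by (auto simp: rots_def)
      then have "dist (U x) (U y) = dist x y"
        using orthogonal_transformation_isometry by blast
      then show ?thesis
        using U xy by (intro less_imp_le unif) (auto simp: orthogonal_transformation_norm)
    qed
    then have "(\<Sum>U\<leftarrow>Us. f (U x)) \<le> (\<Sum>U\<leftarrow>Us. f (U y) + \<epsilon> / 2)"
      by (intro sum_list_mono) auto
    also have "\<dots> = (\<Sum>U\<leftarrow>Us. f (U y)) + length Us * (\<epsilon> / 2)"
      by (simp add: sum_list_addf sum_list_triv)
    finally show ?thesis
      using Us by (auto simp: rotation_mean_def rots_def field_simps)
  qed
  obtain net :: "(real ^ 'd) list" where net: "set net \<subseteq> sphere 0 1" "net \<noteq> []"
    "\<And>x. norm x = 1 \<Longrightarrow> \<exists>p\<in>set net. dist p x < \<delta>"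
  proof -
    obtain K :: "(real ^ 'd) set" where K: "finite K" "K \<subseteq> sphere 0 1" "sphere 0 1 \<subseteq> (\<Union>x\<in>K. ball x \<delta>)"
      using compactE_image[of "sphere (0 :: real ^ 'd) 1" "sphere 0 1" "\<lambda>x. ball x \<delta>"] \<delta>
      by (metis UN_I centre_in_ball compact_sphere open_ball subsetI)
    obtain ps where ps: "set ps = K" using K(1) finite_list by blast
    moreover have "K \<noteq> {}"
    proof
      assume "K = {}"
      moreover have "axis undefined 1 \<in> sphere (0 :: real ^ 'd) 1" by simp
      ultimately show False using K(3) by blast
    qed
    ultimately show ?thesis
      using K(2,3) by (intro that[of ps]) force+
  qed
  define N where "N = real (length net)"
  have N: "N > 0" using net(2) by (simp add: N_def)
  have "bounds \<noteq> {}"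
  proof -
    have "[id] \<in> rots" by (simp add: rots_def id_def)
    moreover have "compact (f ` sphere 0 1)"
      using f by (intro compact_continuous_image) (auto intro: continuous_on_subset)
    then obtain b where "\<forall>x\<in>sphere 0 1. \<bar>f x\<bar> \<le> b"
      using compact_imp_bounded[of "f ` sphere 0 1"] by (auto simp: bounded_iff)
    then have "\<forall>x. norm x = 1 \<longrightarrow> rotation_mean f [id] x \<le> b"
      by (simp add: rotation_mean_def abs_le_iff)
    ultimately show ?thesis by (auto simp: bounds_def)
  qed
  have low: "\<exists>p. norm p = 1 \<and> rotation_mean f Us p \<le> m" if "Us \<in> rots" for Us
  proof -
    have Us: "Us \<noteq> []" "\<And>U. U \<in> set Us \<Longrightarrow> orthogonal_transformation U"
      using that by (auto simp: rots_def)
    obtain p where "norm p = 1" "rotation_mean f Us p \<le> (\<integral>x. rotation_mean f Us x \<partial>sphere_measure)"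
      using exists_point_le_spherical_mean[OF continuous_on_rotation_mean[OF f Us(2)]] by blast
    then show ?thesis
      using integral_rotation_mean[OF f Us(2) Us(1)] by (auto simp: m_def)
  qed
  have bdd: "bdd_below bounds"
  proof (rule bdd_belowI)
    fix b assume "b \<in> bounds"
    then obtain Us where Us: "Us \<in> rots" "\<And>x. norm x = 1 \<Longrightarrow> rotation_mean f Us x \<le> b"
      by (auto simp: bounds_def)
    have "m = (\<integral>x. rotation_mean f Us x \<partial>sphere_measure)"
      using integral_rotation_mean[OF f, of Us] Us(1) by (simp add: rots_def m_def)
    also have "\<dots> \<le> b"
      using Us AE_sphere_measure
      by (intro prob_space.integral_le_const[OF prob_space_sphere_measure] integrable_sphere_measure
          continuous_on_rotation_mean[OF f]) (auto simp: rots_def elim!: eventually_mono)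
    finally show "m \<le> b" .
  qed
  have improve: "b - (b - (m + \<epsilon> / 2)) / N \<in> bounds" if b: "b \<in> bounds" for b
  proof -
    obtain Us where Us: "Us \<in> rots" "\<And>x. norm x = 1 \<Longrightarrow> rotation_mean f Us x \<le> b"
      using b by (auto simp: bounds_def)
    obtain q where q: "norm q = 1" "rotation_mean f Us q \<le> m"
      using low[OF Us(1)] by blast
    have "\<exists>V. orthogonal_transformation V \<and> V p = q" if "p \<in> set net" for p
    proof -
      have "norm p = norm q" using that net(1) q(1) by auto
      then show ?thesis using orthogonal_transformation_exists by blast
    qed
    then obtain V where V: "\<And>p. p \<in> set net \<Longrightarrow> orthogonal_transformation (V p)"
        "\<And>p. p \<in> set net \<Longrightarrow> V p p = q"
      by metis
    define Ws where "Ws = concat (map (\<lambda>V. map (\<lambda>U. U \<circ> V) Us) (map V net))"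
    have "Ws \<in> rots"
      using Us(1) V(1) net(2) by (auto simp: Ws_def rots_def intro: orthogonal_transformation_compose)
    moreover have "rotation_mean f Ws x \<le> b - (b - (m + \<epsilon> / 2)) / N" if x: "norm x = 1" for x
    proof -
      define h where "h = rotation_mean f Us"
      obtain p where p: "p \<in> set net" "dist p x < \<delta>" using net(3) x by blast
      have nV: "norm (V p' x) = 1" if "p' \<in> set net" for p'
        using V(1)[OF that] x by (simp add: orthogonal_transformation_norm)
      have "dist (V p x) q < \<delta>"
        using p V[OF p(1)] orthogonal_transformation_isometry[of "V p"] by (metis dist_commute)
      then have "h (V p x) \<le> m + \<epsilon> / 2"
        using equi[OF Us(1) nV[OF p(1)] q(1)] q(2) by (simp add: h_def)
      moreover have "(\<Sum>p'\<leftarrow>remove1 p net. h (V p' x)) \<le> (\<Sum>p'\<leftarrow>remove1 p net. b)"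
        using Us(2) nV by (intro sum_list_mono) (auto simp: h_def dest: notin_set_remove1)
      moreover have "\<dots> = (N - 1) * b"
        using p(1) length_pos_if_in_set[OF p(1)] by (simp add: sum_list_triv length_remove1 N_def of_nat_diff Suc_leI)
      moreover have "(\<Sum>p'\<leftarrow>net. h (V p' x)) = h (V p x) + (\<Sum>p'\<leftarrow>remove1 p net. h (V p' x))"
        using p(1) by (rule sum_list_map_remove1)
      ultimately have "(\<Sum>p'\<leftarrow>net. h (V p' x)) \<le> (m + \<epsilon> / 2) + (N - 1) * b" by linarith
      moreover have "rotation_mean f Ws x = (\<Sum>p'\<leftarrow>net. h (V p' x)) / N"
        using Us(1) unfolding Ws_def h_def N_def
        by (subst rotation_mean_compose) (auto simp: rots_def rotation_mean_def[of _ "map V net"] o_def)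
      ultimately show ?thesis
        using N by (simp add: field_simps)
    qed
    ultimately show ?thesis by (auto simp: bounds_def)
  qed
  have "Inf bounds < m + \<epsilon>"
  proof (rule ccontr)
    assume "\<not> Inf bounds < m + \<epsilon>"
    then have ge: "m + \<epsilon> \<le> Inf bounds" by simp
    \<comment> \<open>a bound this close to the infimum would be improved beyond the infimum\<close>
    have "Inf bounds < Inf bounds + \<epsilon> / (2 * N)" using N \<open>0 < \<epsilon>\<close> by simp
    then obtain b where b: "b \<in> bounds" "b < Inf bounds + \<epsilon> / (2 * N)"
      using cInf_lessD[OF \<open>bounds \<noteq> {}\<close>] by blast
    have "Inf bounds \<le> b" using b(1) bdd by (rule cInf_lower)
    then have "\<epsilon> / 2 \<le> b - (m + \<epsilon> / 2)" using ge by linarith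
    then have "\<epsilon> / 2 / N \<le> (b - (m + \<epsilon> / 2)) / N"
      using N by (intro divide_right_mono) auto
    moreover have "Inf bounds \<le> b - (b - (m + \<epsilon> / 2)) / N"
      using improve[OF b(1)] bdd by (rule cInf_lower)
    ultimately show False using b(2) by simp
  qed
  then obtain b where b: "b \<in> bounds" "b < m + \<epsilon>"
    using cInf_lessD[OF \<open>bounds \<noteq> {}\<close>] by blast
  then obtain Us where "Us \<in> rots" "\<And>x. norm x = 1 \<Longrightarrow> rotation_mean f Us x \<le> b"
    by (auto simp: bounds_def)
  then show ?thesis
    using b(2) that[of Us] by (force simp: rots_def m_def)
qed

section \<open>Membership tests for spectrahedra\<close>

lemma trace_scaleR: "trace (c *\<^sub>R M) = c * trace (M :: real ^ 'n ^ 'n)"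
  by (simp add: trace_def sum_distrib_left)

lemma matrix_conjugate_sym:
  assumes "B \<in> sym_mats"
  shows "transpose U ** B ** U \<in> sym_mats"
  using assms by (simp add: sym_mats_def matrix_transpose_mul matrix_mul_assoc)

lemma inner_matrix_conjugate:
  fixes B U :: "real ^ 'n ^ 'n"
  shows "v \<bullet> ((transpose U ** B ** U) *v w) = (U *v v) \<bullet> (B *v (U *v w))"
proof -
  have "v \<bullet> ((transpose U ** B ** U) *v w) = v \<bullet> ((B *v (U *v w)) v* U)"
    by (simp add: matrix_vector_mul_assoc[symmetric])
  also have "\<dots> = ((B *v (U *v w)) v* U) \<bullet> v"
    by (rule inner_commute)
  also have "\<dots> = (B *v (U *v w)) \<bullet> (U *v v)"
    by (rule dot_lmul_matrix)
  finally show ?thesis by (simp only: inner_commute)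
qed

text \<open>
  Conjugating both factors by the same orthogonal matrix conjugates the product and keeps its
  trace, so the pairing of \<open>A\<^sub>j\<close> with \<open>X\<^sub>j\<close> in the final construction does not depend on \<open>j\<close>.
\<close>

lemma trace_mult_orthogonal_conjugates:
  fixes B J Q :: "real ^ 'n ^ 'n"
  assumes "orthogonal_matrix Q"
  shows "trace ((transpose Q ** B ** Q) ** (transpose Q ** J ** Q)) = trace (B ** J)"
proof -
  have "(transpose Q ** B ** Q) ** (transpose Q ** J ** Q)
      = transpose Q ** (B ** (Q ** transpose Q) ** J ** Q)"
    by (simp only: matrix_mul_assoc)
  also have "\<dots> = transpose Q ** (B ** J ** Q)"
    using assms by (simp add: orthogonal_matrix_def)
  finally have "trace ((transpose Q ** B ** Q) ** (transpose Q ** J ** Q))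
      = trace ((B ** J ** Q) ** transpose Q)"
    by (simp only: trace_mul_sym[of "transpose Q" "B ** J ** Q"])
  also have "(B ** J ** Q) ** transpose Q = B ** J ** (Q ** transpose Q)"
    by (simp only: matrix_mul_assoc)
  finally show ?thesis
    using assms by (simp add: orthogonal_matrix_def)
qed

text \<open>
  The vector \<open>\<Sum>i. e\<^sub>i \<otimes> e\<^sub>i\<close>. On it, the quadratic form of a Kronecker product is a trace pairing, which is
  how a failure of positivity is detected.
\<close>

definition vec_mat_1 :: "real ^ ('n::finite \<times> 'n)" where
  "vec_mat_1 = (\<chi> p. if fst p = snd p then 1 else 0)"

lemma sum_diagonal:
  fixes f :: "'n::finite \<times> 'n \<Rightarrow> real"
  shows "(\<Sum>p\<in>UNIV. (if fst p = snd p then 1 else 0) * f p) = (\<Sum>i\<in>UNIV. f (i, i))"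
proof -
  have "(\<Sum>p\<in>UNIV. (if fst p = snd p then 1 else 0) * f p)
      = (\<Sum>i\<in>UNIV. \<Sum>j\<in>UNIV. (if i = j then 1 else 0) * f (i, j))"
    by (simp add: sum.cartesian_product UNIV_Times_UNIV split_beta)
  also have "\<dots> = (\<Sum>i\<in>UNIV. \<Sum>j\<in>UNIV. if i = j then f (i, j) else 0)"
    by (intro sum.cong) auto
  finally show ?thesis by simp
qed

lemma inner_vec_mat_1: "vec_mat_1 \<bullet> (vec_mat_1 :: real ^ ('n::finite \<times> 'n)) = real CARD('n)"
proof -
  have "vec_mat_1 \<bullet> (vec_mat_1 :: real ^ ('n::finite \<times> 'n))
      = (\<Sum>p\<in>(UNIV :: ('n \<times> 'n) set). (if fst p = snd p then 1 else 0) * (if fst p = snd p then 1 else (0::real)))"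
    by (simp add: inner_vec_def vec_mat_1_def)
  also have "\<dots> = (\<Sum>i\<in>(UNIV :: 'n set). 1)" unfolding sum_diagonal by simp
  finally show ?thesis by simp
qed

lemma inner_kron_vec_mat_1:
  fixes A X :: "real ^ 'n ^ 'n"
  shows "vec_mat_1 \<bullet> ((A \<otimes>\<^sub>K X) *v vec_mat_1) = trace (A ** transpose X)"
proof -
  have "((A \<otimes>\<^sub>K X) *v vec_mat_1) $ p
      = (\<Sum>q\<in>UNIV. (if fst q = snd q then 1 else 0) * (A $ fst p $ fst q * X $ snd p $ snd q))" for p
    by (simp add: matrix_vector_mult_def kron_def vec_mat_1_def mult_ac)
  then have *: "((A \<otimes>\<^sub>K X) *v vec_mat_1) $ p = (\<Sum>j\<in>UNIV. A $ fst p $ j * X $ snd p $ j)" for p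
    by (simp only: sum_diagonal fst_conv snd_conv)
  have "vec_mat_1 \<bullet> ((A \<otimes>\<^sub>K X) *v vec_mat_1)
      = (\<Sum>p\<in>UNIV. (if fst p = snd p then 1 else 0) * ((A \<otimes>\<^sub>K X) *v vec_mat_1) $ p)"
    by (simp add: inner_vec_def vec_mat_1_def)
  also have "\<dots> = (\<Sum>i\<in>UNIV. ((A \<otimes>\<^sub>K X) *v vec_mat_1) $ (i, i))"
    by (rule sum_diagonal)
  also have "\<dots> = trace (A ** transpose X)"
    by (simp add: * trace_def matrix_matrix_mult_def transpose_def)
  finally show ?thesis .
qed

lemma sum_matrix_vector_mult:
  "(\<Sum>j\<in>I. M j) *v v = (\<Sum>j\<in>I. M j *v v)"
  by (induction I rule: infinite_finite_induct) (auto simp: matrix_vector_mult_add_rdistrib)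

text \<open>
  Positivity of the linear pencil at \<open>Y\<close>, tested on the single vector \<open>vec_mat_1\<close>.
\<close>

lemma free_spectrahedron_trace_le:
  fixes A Y :: "(real ^ 'n ^ 'n) list"
  assumes "Y \<in> free_spectrahedron A"
  shows "(\<Sum>j<length A. trace (A ! j ** Y ! j)) \<le> CARD('n)"
proof -
  let ?v = "vec_mat_1 :: real ^ ('n \<times> 'n)"
  have sym: "transpose (Y ! j) = Y ! j" if "j < length A" for j
  proof -
    have "Y ! j \<in> set Y" "set Y \<subseteq> sym_mats"
      using assms that by (auto simp: free_spectrahedron_def sym_tuples_def)
    then show ?thesis by (auto simp: sym_mats_def)
  qed
  have "0 \<le> ?v \<bullet> ((mat 1 - (\<Sum>j<length A. (A ! j) \<otimes>\<^sub>K (Y ! j))) *v ?v)"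
    using assms unfolding free_spectrahedron_def psd_def by blast
  also have "\<dots> = CARD('n) - (\<Sum>j<length A. trace (A ! j ** transpose (Y ! j)))"
    by (simp add: matrix_vector_mult_diff_rdistrib inner_diff_right inner_vec_mat_1
        sum_matrix_vector_mult inner_sum_right inner_kron_vec_mat_1)
  finally show ?thesis using sym by simp
qed

text \<open>
  The worst point of the cube for a given \<open>v\<close> is the one whose coordinates are the signs of the
  numbers \<open>v \<bullet> A\<^sub>j v\<close>; this turns the condition over all cube points into one inequality.
\<close>

lemma cube_subset_spectrahedronI:
  fixes A :: "(real ^ 'n ^ 'n) list"
  assumes A: "A \<in> sym_tuples g" and le: "\<And>v. (\<Sum>j<g. \<bar>v \<bullet> (A ! j *v v)\<bar>) \<le> v \<bullet> v"
  shows "cube g \<subseteq> spectrahedron A"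
proof
  fix x assume x: "x \<in> cube g"
  have len: "length A = g" "length x = g" using A x by (auto simp: sym_tuples_def cube_def)
  have Aj: "A ! j \<in> sym_mats" if "j < g" for j
    using A that by (auto simp: sym_tuples_def)
  have xj: "\<bar>x ! j\<bar> \<le> 1" if "j < g" for j
    using x that nth_mem[of j x] by (force simp: cube_def abs_le_iff)
  have apply_eq: "(mat 1 - (\<Sum>j<g. (x ! j) *\<^sub>R (A ! j))) *v v = v - (\<Sum>j<g. (x ! j) *\<^sub>R (A ! j *v v))" for v
    by (simp add: matrix_vector_mult_diff_rdistrib sum_matrix_vector_mult scaleR_matrix_vector_assoc)
  have "psd (mat 1 - (\<Sum>j<g. (x ! j) *\<^sub>R (A ! j)))"
    unfolding psd_def sym_mats_iff apply_eq
  proof (intro conjI allI)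
    fix v w :: "real ^ 'n"
    have "(\<Sum>j<g. x ! j * ((A ! j *v v) \<bullet> w)) = (\<Sum>j<g. x ! j * (v \<bullet> (A ! j *v w)))"
      using Aj by (intro sum.cong) (auto simp: sym_mats_iff)
    then show "(v - (\<Sum>j<g. (x ! j) *\<^sub>R (A ! j *v v))) \<bullet> w = v \<bullet> (w - (\<Sum>j<g. (x ! j) *\<^sub>R (A ! j *v w)))"
      by (simp add: inner_diff_left inner_diff_right inner_sum_left inner_sum_right)
    have "(\<Sum>j<g. x ! j * (v \<bullet> (A ! j *v v))) \<le> (\<Sum>j<g. \<bar>v \<bullet> (A ! j *v v)\<bar>)"
    proof (intro sum_mono)
      fix j assume "j \<in> {..<g}"
      have "x ! j * (v \<bullet> (A ! j *v v)) \<le> \<bar>x ! j\<bar> * \<bar>v \<bullet> (A ! j *v v)\<bar>"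
        by (metis abs_ge_self abs_mult)
      also have "\<dots> \<le> 1 * \<bar>v \<bullet> (A ! j *v v)\<bar>"
        using xj \<open>j \<in> {..<g}\<close> by (intro mult_right_mono) auto
      finally show "x ! j * (v \<bullet> (A ! j *v v)) \<le> \<bar>v \<bullet> (A ! j *v v)\<bar>" by simp
    qed
    then show "0 \<le> v \<bullet> (v - (\<Sum>j<g. (x ! j) *\<^sub>R (A ! j *v v)))"
      using le[of v] by (simp add: inner_diff_right inner_sum_right)
  qed
  then show "x \<in> spectrahedron A"
    by (simp add: spectrahedron_def len)
qed

section \<open>Tightness of the constant\<close>

text \<open>
  The averaging result for \<open>\<xi> \<mapsto> \<bar>\<xi> \<bullet> B \<xi>\<bar>\<close>, carried from the sphere to all vectors by homogeneity of
  degree two.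
\<close>

lemma rotation_average_quadratic_form:
  fixes B :: "real ^ 'd ^ 'd" and r :: real
  assumes "(\<integral>\<xi>. \<bar>\<xi> \<bullet> (B *v \<xi>)\<bar> \<partial>sphere_measure) < r"
  obtains Qs :: "(real ^ 'd ^ 'd) list" where "Qs \<noteq> []" "\<And>Q. Q \<in> set Qs \<Longrightarrow> orthogonal_matrix Q"
    "\<And>v. (\<Sum>j<length Qs. \<bar>v \<bullet> ((transpose (Qs ! j) ** B ** Qs ! j) *v v)\<bar>) \<le> length Qs * r * (v \<bullet> v)"
proof -
  define f where "f \<xi> = \<bar>\<xi> \<bullet> (B *v \<xi>)\<bar>" for \<xi>
  have f: "continuous_on UNIV f"
    unfolding f_def by (intro continuous_intros matrix_vector_mult_linear_continuous_on)
  obtain Us :: "(real ^ 'd \<Rightarrow> real ^ 'd) list" where Us: "Us \<noteq> []"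
      "\<And>U. U \<in> set Us \<Longrightarrow> orthogonal_transformation U"
    and le: "\<And>x. norm x = 1 \<Longrightarrow> rotation_mean f Us x \<le> r"
    using rotation_mean_le_spherical_mean[OF f, of "r - (\<integral>\<xi>. f \<xi> \<partial>sphere_measure)"] assms
    unfolding f_def by (auto simp: algebra_simps)
  define Qs where "Qs = map matrix Us"
  have Qs: "(Qs ! j) *v v = (Us ! j) v" if "j < length Us" for j v
    using Us(2)[of "Us ! j"] that by (simp add: Qs_def matrix_works orthogonal_transformation_linear)
  have "(\<Sum>j<length Qs. \<bar>v \<bullet> ((transpose (Qs ! j) ** B ** Qs ! j) *v v)\<bar>) \<le> length Qs * r * (v \<bullet> v)" for v
  proof -
    have len: "length Qs = length Us" by (simp add: Qs_def)
    have "(\<Sum>j<length Qs. \<bar>v \<bullet> ((transpose (Qs ! j) ** B ** Qs ! j) *v v)\<bar>) = (\<Sum>j<length Us. f ((Us ! j) v))"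
      unfolding len by (intro sum.cong) (auto simp: inner_matrix_conjugate Qs f_def)
    also have "\<dots> = (\<Sum>U\<leftarrow>Us. f (U v))"
      by (simp add: sum_list_sum_nth atLeast0LessThan)
    also have "\<dots> \<le> length Us * r * (v \<bullet> v)"
    proof (cases "v = 0")
      case True
      have "(\<Sum>U\<leftarrow>Us. f (U 0)) = (\<Sum>U\<leftarrow>Us. 0)"
        using Us(2) by (intro arg_cong[of _ _ sum_list] map_cong)
          (auto simp: f_def linear_0 orthogonal_transformation_linear)
      then show ?thesis using True by simp
    next
      case False
      have "f (U v) = (v \<bullet> v) * f (U (sgn v))" if "U \<in> set Us" for U
      proof -
        have "U v = norm v *\<^sub>R U (sgn v)"
          using Us(2)[OF that] False
          by (simp add: orthogonal_transformation_linear linear_scale sgn_div_norm)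
        then show ?thesis
          by (simp add: f_def linear_scale[OF matrix_vector_mul_linear] abs_mult dot_square_norm power2_eq_square)
      qed
      then have "(\<Sum>U\<leftarrow>Us. f (U v)) = (\<Sum>U\<leftarrow>Us. (v \<bullet> v) * f (U (sgn v)))"
        by (intro arg_cong[of _ _ sum_list] map_cong) auto
      also have "\<dots> = (v \<bullet> v) * (length Us * rotation_mean f Us (sgn v))"
        using Us(1) by (simp add: sum_list_const_mult rotation_mean_def)
      also have "\<dots> \<le> (v \<bullet> v) * (length Us * r)"
        using le[of "sgn v"] False by (intro mult_left_mono) (auto simp: norm_sgn)
      finally show ?thesis by (simp add: mult_ac)
    qed
    finally show ?thesis by (simp add: len)
  qed
  moreover have "orthogonal_matrix Q" if "Q \<in> set Qs" for Q
    using that Us(2) by (auto simp: Qs_def orthogonal_transformation_matrix)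
  ultimately show ?thesis using that[of Qs] Us(1) by (auto simp: Qs_def)
qed

text \<open>
  Admissible matrices come arbitrarily close to the infimum once there is one; the identity is the
  example that excludes the infimum of the empty set, whose value is unspecified.
\<close>

lemma theta_gt_witness:
  assumes "0 < \<theta>'" and "\<theta>' < theta TYPE('d::finite)"
  obtains B :: "real ^ 'd ^ 'd" where "B \<in> sym_mats" "trace (mat_abs B) = CARD('d)"
    "(\<integral>\<xi>. \<bar>\<xi> \<bullet> (B *v \<xi>)\<bar> \<partial>sphere_measure) < 1 / \<theta>'"
proof -
  define S where "S = {\<integral>\<xi>. \<bar>\<xi> \<bullet> (B *v \<xi>)\<bar> \<partial>sphere_measure | B :: real ^ 'd ^ 'd.
     B \<in> sym_mats \<and> trace (mat_abs B) = real CARD('d)}"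
  have less: "\<theta>' < 1 / Inf S" using assms(2) by (simp add: theta_def S_def)
  then have "Inf S > 0" using assms(1) by (smt (verit) divide_nonneg_nonpos)
  then have "Inf S < 1 / \<theta>'"
    using less assms(1) by (simp add: field_simps)
  moreover have "(\<integral>\<xi>. \<bar>\<xi> \<bullet> ((mat 1 :: real ^ 'd ^ 'd) *v \<xi>)\<bar> \<partial>sphere_measure) \<in> S"
    unfolding S_def
    by (intro CollectI exI[of _ "mat 1"] conjI refl) (simp_all add: mat_abs_mat_1 sym_mats_def trace_I)
  then have "S \<noteq> {}" by (metis empty_iff)
  ultimately obtain s where "s \<in> S" "s < 1 / \<theta>'"
    using cInf_lessD[of S "1 / \<theta>'"] by metis
  then show ?thesis
    using that unfolding S_def by (elim CollectE exE conjE) simp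
qed

theorem theorem1p7:
  fixes \<theta>' :: real
  assumes "1 \<le> \<theta>'" and "\<theta>' < theta TYPE('d::finite)"
  shows "\<exists>g\<ge>1. \<exists>A \<in> (sym_tuples g :: (real ^ 'd ^ 'd) list set).
    cube g \<subseteq> spectrahedron A \<and>
    \<not> (free_cube g :: (real ^ 'd ^ 'd) list set) \<subseteq> scale_tuples \<theta>' (free_spectrahedron A)"
proof -
  have pos: "0 < \<theta>'" using assms(1) by simp
  obtain B :: "real ^ 'd ^ 'd" where B: "B \<in> sym_mats" "trace (mat_abs B) = CARD('d)"
    and intB: "(\<integral>\<xi>. \<bar>\<xi> \<bullet> (B *v \<xi>)\<bar> \<partial>sphere_measure) < 1 / \<theta>'"
    using theta_gt_witness[OF pos assms(2)] by blast
  obtain r :: real where r: "(\<integral>\<xi>. \<bar>\<xi> \<bullet> (B *v \<xi>)\<bar> \<partial>sphere_measure) < r" "r < 1 / \<theta>'"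
    using dense[OF intB] by blast
  have "0 \<le> (\<integral>\<xi>. \<bar>\<xi> \<bullet> (B *v \<xi>)\<bar> \<partial>sphere_measure)"
    by (intro Bochner_Integration.integral_nonneg) simp
  with r(1) have "0 < r" by (rule le_less_trans[rotated])
  obtain Qs where Qs: "Qs \<noteq> []" "\<And>Q. Q \<in> set Qs \<Longrightarrow> orthogonal_matrix Q"
    and le: "\<And>v. (\<Sum>j<length Qs. \<bar>v \<bullet> ((transpose (Qs ! j) ** B ** Qs ! j) *v v)\<bar>) \<le> length Qs * r * (v \<bullet> v)"
    using rotation_average_quadratic_form[OF r(1)] by blast
  obtain J where J: "J \<in> sym_mats" "\<And>v. norm (J *v v) \<le> norm v" "B ** J = mat_abs B"
    using sign_matrix[OF B(1)] by blast
  define g where "g = length Qs"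
  have g: "g \<ge> 1" using Qs(1) by (simp add: g_def Suc_leI)
  \<comment> \<open>the largest factor for which the averaged bound puts the cube inside the spectrahedron\<close>
  define s where "s = 1 / (g * r)"
  have s: "s > 0" using g \<open>0 < r\<close> by (simp add: s_def)
  define A where "A = map (\<lambda>Q. s *\<^sub>R (transpose Q ** B ** Q)) Qs"
  define X where "X = map (\<lambda>Q. transpose Q ** J ** Q) Qs"
  have A: "A \<in> sym_tuples g"
    using matrix_conjugate_sym[OF B(1)]
    by (auto simp: A_def sym_tuples_def g_def sym_mats_def transpose_scalar)
  have "cube g \<subseteq> spectrahedron A"
  proof (rule cube_subset_spectrahedronI[OF A])
    fix v
    have "(\<Sum>j<g. \<bar>v \<bullet> (A ! j *v v)\<bar>) = s * (\<Sum>j<g. \<bar>v \<bullet> ((transpose (Qs ! j) ** B ** Qs ! j) *v v)\<bar>)"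
      using s by (simp add: A_def g_def sum_distrib_left abs_mult scaleR_matrix_vector_assoc[symmetric])
    also have "\<dots> \<le> s * (g * r * (v \<bullet> v))"
      using s le[of v] by (intro mult_left_mono) (auto simp: g_def)
    also have "\<dots> = v \<bullet> v" using g \<open>0 < r\<close> by (simp add: s_def)
    finally show "(\<Sum>j<g. \<bar>v \<bullet> (A ! j *v v)\<bar>) \<le> v \<bullet> v" .
  qed
  moreover have "X \<in> free_cube g"
  proof -
    have "onorm ((*v) (transpose Q ** J ** Q)) \<le> 1" if "Q \<in> set Qs" for Q
    proof (rule onorm_le)
      fix v
      have "orthogonal_transformation ((*v) Q)" "orthogonal_transformation ((*v) (transpose Q))"
        using Qs(2)[OF that] by (simp_all add: orthogonal_transformation_matrix orthogonal_matrix_transpose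
            del: transpose_matrix_vector)
      then have Q: "norm (Q *v v) = norm v" "norm (transpose Q *v w) = norm w" for v w
        by (blast intro: orthogonal_transformation_norm)+
      show "norm ((transpose Q ** J ** Q) *v v) \<le> 1 * norm v"
        using J(2)[of "Q *v v"] by (simp add: matrix_vector_mul_assoc[symmetric] Q del: transpose_matrix_vector)
    qed
    then show ?thesis
      using matrix_conjugate_sym[OF J(1)]
      by (auto simp: X_def free_cube_def sym_tuples_def g_def)
  qed
  moreover have "X \<notin> scale_tuples \<theta>' (free_spectrahedron A)"
  proof
    assume "X \<in> scale_tuples \<theta>' (free_spectrahedron A)"
    then obtain Y where Y: "Y \<in> free_spectrahedron A" "X = map ((*\<^sub>R) \<theta>') Y"
      by (auto simp: scale_tuples_def)
    have lenY: "length Y = g" using A Y(1) by (simp add: free_spectrahedron_def sym_tuples_def)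
    have "trace (A ! j ** Y ! j) = s * CARD('d) / \<theta>'" if "j < g" for j
    proof -
      have "X ! j = \<theta>' *\<^sub>R Y ! j" using that lenY Y(2) by simp
      then have "Y ! j = (1 / \<theta>') *\<^sub>R (X ! j)" using pos by simp
      also have "X ! j = transpose (Qs ! j) ** J ** Qs ! j" using that by (simp add: X_def g_def)
      finally have "A ! j ** Y ! j = (s / \<theta>') *\<^sub>R ((transpose (Qs ! j) ** B ** Qs ! j)
          ** (transpose (Qs ! j) ** J ** Qs ! j))"
        using that by (simp add: A_def g_def matrix_scalar_ac scalar_matrix_assoc[symmetric])
      then show ?thesis
        using Qs(2)[of "Qs ! j"] that B(2) J(3)
        by (simp add: trace_scaleR trace_mult_orthogonal_conjugates g_def)
    qed
    then have "(\<Sum>j<g. trace (A ! j ** Y ! j)) = g * (s * CARD('d) / \<theta>')" by simp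
    also have "\<dots> = CARD('d) * (1 / (r * \<theta>'))"
      using g by (simp add: s_def)
    finally have "CARD('d) * (1 / (r * \<theta>')) \<le> CARD('d) * (1::real)"
      using free_spectrahedron_trace_le[OF Y(1)] A by (simp add: sym_tuples_def)
    then have "1 / (r * \<theta>') \<le> 1"
      by (subst (asm) mult_le_cancel_left_pos) auto
    then show False using r(2) pos \<open>0 < r\<close> by (simp add: field_simps)
  qed
  ultimately show ?thesis using g A by blast
qed

end
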